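(* Let $n\ge 1$ and let $T$ be an $n\times n$ totally positive Hessenberg Toeplitz matrix belonging to $\mathcal{H}^{\ge 0}$. Then $T$ has the LU decomposition $T=LU$, where $L$ and $U$ are the $n\times n$ matrices with entries $$ (L)_{ij}=\begin{cases}0 & i<j,\\[4pt] \dfrac{\tau^{\mathrm{init}}_{\{i\}\cup[j-1]}(T)}{\tau^{\mathrm{init}}_{[j]}(T)} & i\ge j,\end{cases} \qquad (U)_{ij}=\begin{cases}\dfrac{\tau^{\mathrm{init}}_{[i]}(T)}{\tau^{\mathrm{init}}_{[i-1]}(T)} & i=j,\\[4pt] 1 & j=i+1,\\ 0 & \text{otherwise.}\end{cases} $$
   Context: All matrices are real. An $n\times n$ matrix is (lower) Hessenberg if all its entries $(i,i+1)$ on the first superdiagonal equal $1$ and all its entries $(i,j)$ with $j>i+1$ equal $0$. A matrix is Toeplitz if it is constant along each diagonal, i.e. its $(i,j)$ entry depends only on $j-i$. A matrix is totally positive (TP) if all its minors are non-negative. Let $N_-^{\ge 0}$ be the set of $n\times n$ lower unipotent matrices (lower triangular with $1$'s on the diagonal) that are TP, and let $\mathcal{B}^{\ge 0}$ be the set of $n\times n$ upper bidiagonal matrices with $1$'s on the superdiagonal, all diagonal entries strictly positive, and all other entries $0$. $\mathcal{H}^{\ge 0}$ denotes the set of totally positive Hessenberg matrices of the form $L'U'$ with $L'\in N_-^{\ge 0}$ and $U'\in\mathcal{B}^{\ge 0}$. For an integer $m\ge 1$, $[m]=\{1,\dots,m\}$, and $[m]=\emptyset$ for $m<1$. For an $n\times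 n$ matrix $A$ and non-empty $S\subseteq\{1,\dots,n\}$, $\tau^{\mathrm{init}}_S(A)=\det\left(A_{S,[|S|]}\right)$ is the minor of $A$ with rows indexed by $S$ (in increasing order) and columns the first $|S|$ columns; $\tau^{\mathrm{init}}_\emptyset(A)=1$. *)

theory Defs
  imports "Jordan_Normal_Form.Determinant" "Jordan_Normal_Form.DL_Submatrix"
begin

text \<open>
  Matrices are indexed from 0: row (column) \<open>i\<close> here is row (column) \<open>i + 1\<close> in the
  usual numbering, so the set \<open>[m] = {1, ..., m}\<close> of rows or columns becomes \<open>{0..<m}\<close>.
\<close>

text \<open>Here \<open>hessenberg\<close> always means lower Hessenberg with unit superdiagonal.\<close>

definition hessenberg :: "real mat \<Rightarrow> bool" where
  "hessenberg A \<longleftrightarrow> square_mat A \<and>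
     (\<forall>i < dim_row A. \<forall>j < dim_col A.
        (j = i + 1 \<longrightarrow> A $$ (i, j) = 1) \<and> (j > i + 1 \<longrightarrow> A $$ (i, j) = 0))"

definition toeplitz :: "real mat \<Rightarrow> bool" where
  "toeplitz A \<longleftrightarrow>
     (\<forall>i < dim_row A. \<forall>j < dim_col A. \<forall>k < dim_row A. \<forall>l < dim_col A.
        int j - int i = int l - int k \<longrightarrow> A $$ (i, j) = A $$ (k, l))"

definition totally_positive :: "real mat \<Rightarrow> bool" where
  "totally_positive A \<longleftrightarrow>
     (\<forall>I J. I \<subseteq> {0..<dim_row A} \<longrightarrow> J \<subseteq> {0..<dim_col A} \<longrightarrow> card I = card J \<longrightarrow>
        det (submatrix A I J) \<ge> 0)"

definition lower_unipotent :: "real mat \<Rightarrow> bool" where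
  "lower_unipotent A \<longleftrightarrow> square_mat A \<and>
     (\<forall>i < dim_row A. A $$ (i, i) = 1) \<and>
     (\<forall>i < dim_row A. \<forall>j < dim_col A. i < j \<longrightarrow> A $$ (i, j) = 0)"

definition N_minus_nonneg :: "nat \<Rightarrow> real mat set" where
  "N_minus_nonneg n = {A \<in> carrier_mat n n. lower_unipotent A \<and> totally_positive A}"

definition B_nonneg :: "nat \<Rightarrow> real mat set" where
  "B_nonneg n = {A \<in> carrier_mat n n.
     \<forall>i < n. \<forall>j < n.
       (i = j \<longrightarrow> A $$ (i, j) > 0) \<and>
       (j = i + 1 \<longrightarrow> A $$ (i, j) = 1) \<and>
       (j \<noteq> i \<and> j \<noteq> i + 1 \<longrightarrow> A $$ (i, j) = 0)}"

definition H_nonneg :: "nat \<Rightarrow> real mat set" where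
  "H_nonneg n = {A \<in> carrier_mat n n. totally_positive A \<and> hessenberg A \<and>
     (\<exists>L' \<in> N_minus_nonneg n. \<exists>U' \<in> B_nonneg n. A = L' * U')}"

definition tau_init :: "nat set \<Rightarrow> real mat \<Rightarrow> real" where
  "tau_init S A = det (submatrix A S {0..<card S})"

lemma tau_init_empty [simp]: "tau_init {} A = 1"
  unfolding tau_init_def by (rule det_dim_zero) (auto simp: dim_submatrix)

definition LU_decomposition :: "real mat \<Rightarrow> real mat \<Rightarrow> real mat \<Rightarrow> bool" where
  "LU_decomposition A L U \<longleftrightarrow>
     lower_unipotent L \<and> square_mat U \<and> upper_triangular U \<and> A = L * U"

text \<open>
  After the shift to 0-based indices, \<open>{i} \<union> [j-1]\<close> is \<open>insert i {0..<j}\<close>, \<open>[j]\<close> is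
  \<open>{0..<j + 1}\<close> and \<open>[i-1]\<close> is \<open>{0..<i}\<close>, which is empty for the first row.
\<close>

definition L_factor :: "nat \<Rightarrow> real mat \<Rightarrow> real mat" where
  "L_factor n T = mat n n (\<lambda>(i, j).
     if i < j then 0
     else tau_init (insert i {0..<j}) T / tau_init {0..<j + 1} T)"

definition U_factor :: "nat \<Rightarrow> real mat \<Rightarrow> real mat" where
  "U_factor n T = mat n n (\<lambda>(i, j).
     if i = j then tau_init {0..<i + 1} T / tau_init {0..<i} T
     else if j = i + 1 then 1
     else 0)"

end

theory Submission
  imports Defs
begin

text \<open>
  Let \<open>T = L' U'\<close> be the factorization witnessing membership in \<open>\<H>\<^sup>\<ge>\<^sup>0\<close>. Since \<open>U'\<close> is upper
  triangular, the submatrix of \<open>T\<close> in rows \<open>{i} \<union> [j-1]\<close> and columns \<open>[j]\<close> is the product of the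
  corresponding submatrix of \<open>L'\<close>, which is lower triangular with diagonal
  \<open>(1, \<dots>, 1, L'\<^sub>i\<^sub>j)\<close>, and the leading principal submatrix of \<open>U'\<close>. Hence its minor is
  \<open>L'\<^sub>i\<^sub>j \<cdot> U'\<^sub>1\<^sub>1 \<cdots> U'\<^sub>j\<^sub>j\<close>, and quotients of such minors give back the entries of \<open>L'\<close> and \<open>U'\<close>.
\<close>

text \<open>An element of a set is picked at the position that counts its smaller elements;
  \<open>j \<le> i\<close> makes \<open>i\<close> the largest index, hence the last one
  picked.\<close>

lemma pick_insert_initial:
  assumes "j \<le> i" "a \<le> j"
  shows "pick (insert i {0..<j}) a = (if a < j then a else i)"
proof (cases "a < j")
  case True
  have "{b \<in> insert i {0..<j}. b < a} = {0..<a}"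
    using assms True by auto
  with pick_card_in_set[of a "insert i {0..<j}"] True show ?thesis
    by simp
next
  case False
  have "{b \<in> insert i {0..<j}. b < i} = {0..<j}"
    using assms by auto
  with pick_card_in_set[of i "insert i {0..<j}"] False assms show ?thesis
    by simp
qed

lemma tau_init_insert:
  assumes A: "A \<in> carrier_mat n n" and "j \<le> i" "i < n"
  shows "tau_init (insert i {0..<j}) A =
    det (mat (Suc j) (Suc j) (\<lambda>(a, b). A $$ (if a < j then a else i, b)))"
proof -
  have card: "card (insert i {0..<j}) = Suc j"
    using assms by simp
  have rows: "{a. a < dim_row A \<and> a \<in> insert i {0..<j}} = insert i {0..<j}"
    using assms by auto
  have cols: "{a. a < dim_col A \<and> a \<in> {0..<Suc j}} = {0..<Suc j}"
    using assms by auto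
  \<comment> \<open>\<open>{0..<Suc j}\<close> is \<open>insert j {0..<j}\<close>, so the lemma used
    for the rows also covers the columns.\<close>
  have pick_cols: "pick {0..<Suc j} b = b" if "b < Suc j" for b
    using pick_insert_initial[of j j b] that
    by (cases "b = j") (auto simp: atLeast0_lessThan_Suc)
  have "submatrix A (insert i {0..<j}) {0..<Suc j} =
    mat (Suc j) (Suc j) (\<lambda>(a, b). A $$ (if a < j then a else i, b))"
    unfolding submatrix_def rows cols card
    by (rule eq_matI) (use assms in \<open>auto simp: pick_insert_initial pick_cols\<close>)
  then show ?thesis
    unfolding tau_init_def card by simp
qed

lemma tau_init_insert_LU:
  assumes L: "L \<in> carrier_mat n n" "lower_unipotent L"
    and U: "U \<in> carrier_mat n n" "upper_triangular U"
    and "j \<le> i" "i < n"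
  shows "tau_init (insert i {0..<j}) (L * U) = L $$ (i, j) * (\<Prod>k<Suc j. U $$ (k, k))"
proof -
  define r where "r a = (if a < j then a else i)" for a
  define L1 where "L1 = mat (Suc j) (Suc j) (\<lambda>(a, b). L $$ (r a, b))"
  define U1 where "U1 = mat (Suc j) (Suc j) (\<lambda>(a, b). U $$ (a, b))"
  have carrier: "L1 \<in> carrier_mat (Suc j) (Suc j)" "U1 \<in> carrier_mat (Suc j) (Suc j)"
    by (auto simp: L1_def U1_def)
  have r: "r a < n" for a
    using assms by (auto simp: r_def)
  have "mat (Suc j) (Suc j) (\<lambda>(a, b). (L * U) $$ (r a, b)) = L1 * U1"
  proof (rule eq_matI)
    fix a b assume "a < dim_row (L1 * U1)" "b < dim_col (L1 * U1)"
    then have ab: "a < Suc j" "b < Suc j"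
      using carrier by auto
    have "(L * U) $$ (r a, b) = (\<Sum>k\<in>{0..<n}. L $$ (r a, k) * U $$ (k, b))"
      using L(1) U(1) r[of a] ab assms(5,6) by (auto simp: scalar_prod_def)
    \<comment> \<open>Columns \<open>b \<le> j\<close> of \<open>U\<close> are zero in all rows
      \<open>k > j\<close>, so the inner index can be cut off at \<open>j\<close>.\<close>
    also have "\<dots> = (\<Sum>k\<in>{0..<Suc j}. L $$ (r a, k) * U $$ (k, b))"
      by (rule sum.mono_neutral_right)
        (use U ab assms(5,6) in \<open>auto intro!: upper_triangularD\<close>)
    also have "\<dots> = (L1 * U1) $$ (a, b)"
      using ab by (simp add: L1_def U1_def scalar_prod_def)
    finally show "mat (Suc j) (Suc j) (\<lambda>(a, b). (L * U) $$ (r a, b)) $$ (a, b) = (L1 * U1) $$ (a, b)"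
      using ab by simp
  qed (auto simp: L1_def U1_def)
  then have "tau_init (insert i {0..<j}) (L * U) = det L1 * det U1"
    using tau_init_insert[of "L * U" n j i] L(1) U(1) assms(5,6) det_mult[OF carrier]
    by (simp add: r_def)
  moreover have "det L1 = L $$ (i, j)"
  proof -
    \<comment> \<open>Row \<open>a < j\<close> of \<open>L1\<close> comes from row \<open>a\<close>
      of \<open>L\<close>, zero past the diagonal; the last row comes from row \<open>i\<close> of
      \<open>L\<close> and ends at column \<open>j\<close>, on the diagonal of
      \<open>L1\<close>.\<close>
    have "det L1 = prod_list (diag_mat L1)"
      by (rule det_lower_triangular[OF _ carrier(1)])
        (use L assms(5,6) in \<open>auto simp: L1_def r_def lower_unipotent_def\<close>)
    also have "\<dots> = (\<Prod>a = 0..<Suc j. L $$ (r a, a))"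
      by (simp add: prod_list_diag_prod L1_def)
    also have "\<dots> = L $$ (i, j)"
      using L assms(5,6) by (simp add: r_def lower_unipotent_def)
    finally show ?thesis .
  qed
  moreover have "det U1 = (\<Prod>k<Suc j. U $$ (k, k))"
  proof -
    have "det U1 = prod_list (diag_mat U1)"
      by (rule det_upper_triangular[OF _ carrier(2)])
        (use U assms(5,6) in \<open>auto simp: U1_def intro!: upper_triangularI upper_triangularD[OF U(2)]\<close>)
    also have "\<dots> = (\<Prod>k<Suc j. U $$ (k, k))"
      by (simp add: prod_list_diag_prod U1_def atLeast0LessThan)
    finally show ?thesis .
  qed
  ultimately show ?thesis
    by simp
qed

text \<open>For \<open>j > 0\<close> the last row and column of the minor have the same index, so
  the entry of \<open>L\<close> in the previous lemma is a diagonal \<open>1\<close>.\<close>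

lemma tau_init_initial_LU:
  assumes "L \<in> carrier_mat n n" "lower_unipotent L"
    and "U \<in> carrier_mat n n" "upper_triangular U"
    and "j \<le> n"
  shows "tau_init {0..<j} (L * U) = (\<Prod>k<j. U $$ (k, k))"
proof (cases j)
  case (Suc m)
  with tau_init_insert_LU[OF assms(1-4), of m m] assms show ?thesis
    by (simp add: lower_unipotent_def atLeast0_lessThan_Suc)
qed simp

lemma B_nonneg_upper_triangular: "U \<in> B_nonneg n \<Longrightarrow> upper_triangular U"
  by (auto simp: B_nonneg_def)

text \<open>The minors recover both factors from their product, so a given factorization of this
  shape must be the one in the formulas.\<close>

lemma
  assumes L: "L \<in> carrier_mat n n" "lower_unipotent L" and U: "U \<in> B_nonneg n"
  shows L_factor_mult: "L_factor n (L * U) = L"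
    and U_factor_mult: "U_factor n (L * U) = U"
proof -
  have U_carrier: "U \<in> carrier_mat n n" and pos: "\<And>k. k < n \<Longrightarrow> U $$ (k, k) > 0"
    using U by (auto simp: B_nonneg_def)
  note LU = L U_carrier B_nonneg_upper_triangular[OF U]
  \<comment> \<open>These products are the denominators in both formulas.\<close>
  have nz: "(\<Prod>k<j. U $$ (k, k)) \<noteq> 0" if "j \<le> n" for j
    using pos less_le_trans[OF _ that] by (simp add: less_imp_neq[THEN not_sym])
  show "L_factor n (L * U) = L"
  proof (rule eq_matI)
    fix i j assume "i < dim_row L" "j < dim_col L"
    then have ij: "i < n" "j < n"
      using L by auto
    show "L_factor n (L * U) $$ (i, j) = L $$ (i, j)"
    proof (cases "i < j")
      case True
      then show ?thesis
        using ij L by (simp add: L_factor_def lower_unipotent_def)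
    next
      case False
      then show ?thesis
        using ij nz[of "Suc j"] tau_init_insert_LU[OF LU, of j i]
          tau_init_initial_LU[OF LU, of "Suc j"]
        by (simp add: L_factor_def del: prod.lessThan_Suc)
    qed
  qed (use L in \<open>auto simp: L_factor_def\<close>)
  show "U_factor n (L * U) = U"
  proof (rule eq_matI)
    fix i j assume "i < dim_row U" "j < dim_col U"
    then have ij: "i < n" "j < n"
      using U_carrier by auto
    show "U_factor n (L * U) $$ (i, j) = U $$ (i, j)"
    proof (cases "i = j")
      case True
      \<comment> \<open>Consecutive products differ by the factor \<open>U $$ (i, i)\<close>; for
        \<open>i = 0\<close> the denominator is the empty minor \<open>1\<close>.\<close>
      then show ?thesis
        using ij nz[of i] tau_init_initial_LU[OF LU, of i] tau_init_initial_LU[OF LU, of "Suc i"]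
        by (simp add: U_factor_def)
    next
      case False
      then show ?thesis
        using ij U by (simp add: U_factor_def B_nonneg_def)
    qed
  qed (use U_carrier in \<open>auto simp: U_factor_def\<close>)
qed

theorem theorem2p9:
  fixes n :: nat and T :: "real mat"
  assumes "n \<ge> 1"
    and "T \<in> carrier_mat n n"
    and "totally_positive T"
    and "hessenberg T"
    and "toeplitz T"
    and "T \<in> H_nonneg n"
  shows "LU_decomposition T (L_factor n T) (U_factor n T)"
proof -
  obtain L' U' where L': "L' \<in> carrier_mat n n" "lower_unipotent L'" and U': "U' \<in> B_nonneg n"
    and T: "T = L' * U'"
    using assms(6) by (auto simp: H_nonneg_def N_minus_nonneg_def)
  have "square_mat U'"
    using U' by (auto simp: B_nonneg_def)
  then show ?thesis
    using L' B_nonneg_upper_triangular[OF U']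
    by (simp add: LU_decomposition_def T L_factor_mult[OF L' U'] U_factor_mult[OF L' U'])
qed

end
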